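(* Let $(X,\tau)$ and $(Y,\sigma)$ be topological spaces and let $f \colon (X,\tau) \rightarrow (Y,\sigma)$ be a function. The following conditions are equivalent: (1) $f$ is $SR$-continuous. (2) $f$ is $\beta$-continuous and contra-semicontinuous.
   Context: No separation axioms are assumed and functions are not assumed continuous. For a subset $A$ of a topological space, $\mathrm{Int}(A)$ and $\mathrm{Cl}(A)$ denote interior and closure. $A$ is semi-open if $A \subseteq \mathrm{Cl}(\mathrm{Int}(A))$; semi-closed if its complement is semi-open (equivalently $\mathrm{Int}(\mathrm{Cl}(A)) \subseteq A$); semi-regular if it is both semi-open and semi-closed; $\beta$-open if $A \subseteq \mathrm{Cl}(\mathrm{Int}(\mathrm{Cl}(A)))$. A function $f \colon (X,\tau)\to(Y,\sigma)$ is $SR$-continuous (resp. $\beta$-continuous, contra-semicontinuous) if the preimage of every open subset of $Y$ is semi-regular (resp. $\beta$-open, semi-closed) in $X$. *)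

theory Defs
  imports "HOL-Analysis.Abstract_Topology"
begin

(* Spaces are values of type 'a topology, with carrier topspace X. The inclusions into a
   closure in semi_open_in and beta_open_in already give A \<subseteq> topspace X. *)

definition semi_open_in :: "'a topology \<Rightarrow> 'a set \<Rightarrow> bool" where
  "semi_open_in X A \<longleftrightarrow> A \<subseteq> X closure_of (X interior_of A)"

definition semi_closed_in :: "'a topology \<Rightarrow> 'a set \<Rightarrow> bool" where
  "semi_closed_in X A \<longleftrightarrow> A \<subseteq> topspace X \<and> semi_open_in X (topspace X - A)"

definition semi_regular_in :: "'a topology \<Rightarrow> 'a set \<Rightarrow> bool" where
  "semi_regular_in X A \<longleftrightarrow> semi_open_in X A \<and> semi_closed_in X A"

definition beta_open_in :: "'a topology \<Rightarrow> 'a set \<Rightarrow> bool" where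
  "beta_open_in X A \<longleftrightarrow> A \<subseteq> X closure_of (X interior_of (X closure_of A))"

(* The following notions are meant for functions f with f \<in> topspace X \<rightarrow> topspace Y;
   preimages are taken within the carrier of X. *)

definition SR_continuous_map :: "'a topology \<Rightarrow> 'b topology \<Rightarrow> ('a \<Rightarrow> 'b) \<Rightarrow> bool" where
  "SR_continuous_map X Y f \<longleftrightarrow>
     (\<forall>V. openin Y V \<longrightarrow> semi_regular_in X {x \<in> topspace X. f x \<in> V})"

definition beta_continuous_map :: "'a topology \<Rightarrow> 'b topology \<Rightarrow> ('a \<Rightarrow> 'b) \<Rightarrow> bool" where
  "beta_continuous_map X Y f \<longleftrightarrow>
     (\<forall>V. openin Y V \<longrightarrow> beta_open_in X {x \<in> topspace X. f x \<in> V})"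

definition contra_semicontinuous_map :: "'a topology \<Rightarrow> 'b topology \<Rightarrow> ('a \<Rightarrow> 'b) \<Rightarrow> bool" where
  "contra_semicontinuous_map X Y f \<longleftrightarrow>
     (\<forall>V. openin Y V \<longrightarrow> semi_closed_in X {x \<in> topspace X. f x \<in> V})"

end

theory Submission
  imports Defs
begin

text \<open>The equivalence already holds for each single set A, and is then applied to the
  preimages of open sets (\<open>semi_regular_in_iff_beta_open_in_semi_closed_in\<close>). Since A
  lies in its closure, Cl(Int A) is contained in Cl(Int(Cl A)), so semi-open sets are \<beta>-open.
  For semi-closed A this inclusion is an equality, so \<beta>-open gives back semi-open.\<close>

lemma semi_closed_in_iff_interior_of_closure_of:
  "semi_closed_in X A \<longleftrightarrow> A \<subseteq> topspace X \<and> X interior_of (X closure_of A) \<subseteq> A"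
proof -
  have "X closure_of (X interior_of (topspace X - A)) =
      topspace X - X interior_of (X closure_of A)"
    by (simp add: interior_of_complement closure_of_complement)
  then show ?thesis
    unfolding semi_closed_in_def semi_open_in_def
    \<comment> \<open>Both sets lie in the carrier, so taking complements reverses the
      inclusion.\<close>
    using interior_of_subset_topspace[of X "X closure_of A"] by auto
qed

lemma semi_open_in_imp_beta_open_in:
  assumes "semi_open_in X A"
  shows "beta_open_in X A"
proof -
  \<comment> \<open>\<open>closure_of\<close> stays within the carrier, so A \<subseteq> Cl A needs
    this.\<close>
  have "A \<subseteq> topspace X"
    using assms closure_of_subset_topspace unfolding semi_open_in_def by fast
  then have "X closure_of (X interior_of A) \<subseteq> X closure_of (X interior_of (X closure_of A))"
    by (intro closure_of_mono interior_of_mono closure_of_subset)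
  with assms show ?thesis
    unfolding semi_open_in_def beta_open_in_def by order
qed

lemma beta_open_in_semi_closed_in_imp_semi_open_in:
  assumes "beta_open_in X A" "semi_closed_in X A"
  shows "semi_open_in X A"
proof -
  \<comment> \<open>Int(Cl A) is an open subset of A by semi-closedness, hence inside the largest
    one.\<close>
  have "X interior_of (X closure_of A) \<subseteq> X interior_of A"
    using assms(2) by (simp add: semi_closed_in_iff_interior_of_closure_of interior_of_maximal)
  then have "X closure_of (X interior_of (X closure_of A)) \<subseteq> X closure_of (X interior_of A)"
    by (rule closure_of_mono)
  with assms(1) show ?thesis
    unfolding semi_open_in_def beta_open_in_def by order
qed

lemma semi_regular_in_iff_beta_open_in_semi_closed_in:
  "semi_regular_in X A \<longleftrightarrow> beta_open_in X A \<and> semi_closed_in X A"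
  using semi_open_in_imp_beta_open_in beta_open_in_semi_closed_in_imp_semi_open_in
  unfolding semi_regular_in_def by blast

theorem theorem3p6:
  fixes X :: "'a topology" and Y :: "'b topology" and f :: "'a \<Rightarrow> 'b"
  assumes "f \<in> topspace X \<rightarrow> topspace Y"
  shows "SR_continuous_map X Y f \<longleftrightarrow>
           beta_continuous_map X Y f \<and> contra_semicontinuous_map X Y f"
  unfolding SR_continuous_map_def beta_continuous_map_def contra_semicontinuous_map_def
    semi_regular_in_iff_beta_open_in_semi_closed_in
  by blast

end
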